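(* Consider the following nondeterministic program on states $(x,y,z)\in\mathbb{Z}^3$. Initially $(x,y,z)$ is an arbitrary element of $\mathbb{Z}^3$ supplied by the user. While $x>0$ and $y>0$ and $z>0$, the user chooses a value $\mathrm{control}\in\{1,2,3\}$ and the following (simultaneous) assignment is executed: \begin{itemize} \item if $\mathrm{control}=1$: $(x,y,z)=(x+1,\,y-1,\,z-1)$; \item if $\mathrm{control}=2$: $(x,y,z)=(x-1,\,y+1,\,z-1)$; \item if $\mathrm{control}=3$: $(x,y,z)=(x-1,\,y-1,\,z+1)$. \end{itemize} Then every computation of this program is finite.
   Context: A program is a tuple $(S,I,R)$ where $S$ is a set of states, $I\subseteq S$ is the set of possible initial states, and $R\subseteq S\times S$ is the set of pairs $(s,t)$ such that $s$ satisfies the condition of the while loop and some choice of instruction (and of user inputs) takes $s$ to $t$ in one iteration of the loop body. A computation is a finite or infinite sequence of states $s_1,s_2,\ldots$ with $s_1\in I$, with $R(s_i,s_{i+1})$ for all consecutive terms, and such that if the sequence is finite with last state $s$ then there is no $t$ with $R(s,t)$. Here $S=I=\mathbb{Z}^3$. *)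

theory Defs
  imports Main
begin

record 'a program =
  states :: "'a set"
  initials :: "'a set"
  transition :: "('a \<times> 'a) set"

definition program :: "'a program \<Rightarrow> bool" where
  "program P \<longleftrightarrow> initials P \<subseteq> states P \<and> transition P \<subseteq> states P \<times> states P"

text \<open>Finite or infinite sequences, indexed from 0.\<close>

datatype 'a sequence =
    is_finite: Finite_Seq "'a list"
  | Infinite_Seq "nat \<Rightarrow> 'a"

primrec computation :: "'a program \<Rightarrow> 'a sequence \<Rightarrow> bool" where
  "computation P (Finite_Seq ss) \<longleftrightarrow>
     ss \<noteq> [] \<and> hd ss \<in> initials P \<and>
     (\<forall>i. Suc i < length ss \<longrightarrow> (ss ! i, ss ! Suc i) \<in> transition P) \<and>
     (\<nexists>t. (last ss, t) \<in> transition P)"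
| "computation P (Infinite_Seq f) \<longleftrightarrow>
     f 0 \<in> initials P \<and> (\<forall>i. (f i, f (Suc i)) \<in> transition P)"

type_synonym state = "int \<times> int \<times> int"

fun loop_condition :: "state \<Rightarrow> bool" where
  "loop_condition (x, y, z) \<longleftrightarrow> x > 0 \<and> y > 0 \<and> z > 0"

fun loop_body :: "nat \<Rightarrow> state \<Rightarrow> state" where
  "loop_body control (x, y, z) =
     (if control = 1 then (x + 1, y - 1, z - 1)
      else if control = 2 then (x - 1, y + 1, z - 1)
      else (x - 1, y - 1, z + 1))"

definition control_program :: "state program" where
  "control_program =
     \<lparr> states = UNIV,
       initials = UNIV,
       transition = {(s, t). loop_condition s \<and> (\<exists>control \<in> {1, 2, 3}. t = loop_body control s)} \<rparr>"

lemma program_control_program: "program control_program"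
  by (simp add: program_def control_program_def)

end

theory Submission
  imports Defs
begin

text \<open>The sum \<open>x + y + z\<close> is a ranking function: it strictly drops along each
  transition and is bounded below while the loop runs. Hence the converse of the transition relation
  is well-founded, and an infinite computation would be an infinite descending chain for it.\<close>

lemma computation_finite_if_wf:
  assumes "wf ((transition P)\<inverse>)" and "computation P \<sigma>"
  shows "is_finite \<sigma>"
proof (cases \<sigma>)
  case (Infinite_Seq f)
  then have "\<forall>i. (f (Suc i), f i) \<in> (transition P)\<inverse>"
    using assms(2) by simp
  then show ?thesis
    using assms(1) unfolding wf_iff_no_infinite_down_chain by blast
qed simp

text \<open>Every iteration decreases \<open>x + y + z\<close> by one, whichever control value is chosen, and this sum
  is positive while the loop runs.\<close>

lemma wf_transition_control_program: "wf ((transition control_program)\<inverse>)"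
proof (rule wf_subset)
  \<comment> \<open>Truncation by \<open>nat\<close> is harmless: the loop condition makes the sum
    at least 3 before the step, so the drop by one stays strict.\<close>
  show "(transition control_program)\<inverse> \<subseteq> measure (\<lambda>(x, y, z). nat (x + y + z))"
    by (auto simp: control_program_def)
qed simp

theorem theorem3p1:
  shows "\<forall>\<sigma>. computation control_program \<sigma> \<longrightarrow> is_finite \<sigma>"
  using computation_finite_if_wf[OF wf_transition_control_program] by blast

end
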